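(* For all $n\ge1$ and $0\le k\le n$, $$P_{0,k,2n+1}=(k+1)\binom{n}{k}\binom{n+1}{k+1}(n!)^2=(n+1)\binom{n}{k}^2(n!)^2$$ and $$P_{1,k,2n+1}=\frac{(n+1)(n-k)}{k+1}\binom{n}{k}^2(n!)^2.$$
   Context: $\mathcal{S}_m$ denotes the set of permutations $\sigma=\sigma_1\cdots\sigma_m$ of $\{1,\dots,m\}$. $\overrightarrow{des}_E(\sigma)$ is the number of indices $i\in\{1,\dots,m-1\}$ with $\sigma_i>\sigma_{i+1}$ and $\sigma_{i+1}$ even. For $j\in\{0,1\}$, $P_{j,k,m}$ is the number of $\sigma\in\mathcal{S}_m$ with $\overrightarrow{des}_E(\sigma)=k$ such that $\sigma_1$ is even if $j=1$ and $\sigma_1$ is odd if $j=0$. *)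

theory Defs
  imports Complex_Main "HOL-Combinatorics.Multiset_Permutations"
begin

text \<open>Permutations \<open>\<sigma>\<^sub>1 \<dots> \<sigma>\<^sub>m\<close> are words, i.e. elements of \<^term>\<open>permutations_of_set {1..m}\<close>.
  List positions start at 0, so \<open>\<sigma> ! i\<close> is \<open>\<sigma>\<^sub>i\<^sub>+\<^sub>1\<close>.\<close>

definition des_E :: "nat list \<Rightarrow> nat" where
  "des_E \<sigma> = card {i. Suc i < length \<sigma> \<and> \<sigma> ! i > \<sigma> ! Suc i \<and> even (\<sigma> ! Suc i)}"

text \<open>The first index \<open>j\<close> of \<open>P\<close> is only meant to take the values 0 and 1.\<close>

definition P :: "nat \<Rightarrow> nat \<Rightarrow> nat \<Rightarrow> nat" where
  "P j k m = card {\<sigma> \<in> permutations_of_set {1..m}. des_E \<sigma> = k \<and>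
     (j = 1 \<longrightarrow> even (\<sigma> ! 0)) \<and> (j = 0 \<longrightarrow> odd (\<sigma> ! 0))}"

end

theory Submission
  imports Defs
begin

text \<open>Call a descent whose bottom lies in \<open>X\<close> a descent into \<open>X\<close>. Insert a letter \<open>M\<close>, larger than
  all others, into a word \<open>\<sigma>\<close> on \<open>A\<close>. Wherever it is placed it is not the bottom of a descent, so
  the number of descents into \<open>X\<close> grows by one if the letter that follows \<open>M\<close> lies in \<open>X\<close> and was
  not yet a descent bottom, and is unchanged otherwise. Every letter of \<open>X\<close> not in first position
  is the bottom of a descent or the top of an ascent; hence the number of slots of each kind depends
  only on the number of descents into \<open>X\<close>, on whether \<open>\<sigma>\<^sub>1 \<in> X\<close>, and on the sizes of \<open>A \<inter> X\<close> and
  \<open>A - X\<close>. When the letters alternate between the complement of \<open>X\<close> and \<open>X\<close>, as odd and even numbers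
  do, products of two binomial coefficients solve the resulting recurrence.\<close>

subsection \<open>Inserting a letter into a word\<close>

definition insert_at :: "nat \<Rightarrow> 'a \<Rightarrow> 'a list \<Rightarrow> 'a list" where
  "insert_at i y xs = take i xs @ y # drop i xs"

lemma insert_at_0 [simp]: "insert_at 0 y xs = y # xs"
  by (simp add: insert_at_def)

lemma insert_at_Suc_Cons [simp]: "insert_at (Suc i) y (x # xs) = x # insert_at i y xs"
  by (simp add: insert_at_def)

lemma mset_insert_at [simp]: "mset (insert_at i y xs) = add_mset y (mset xs)"
  unfolding insert_at_def
  by (metis append_take_drop_id mset.simps(2) mset_append union_mset_add_mset_right)

lemma set_insert_at [simp]: "set (insert_at i y xs) = insert y (set xs)"
  by (metis mset_insert_at set_mset_add_mset_insert set_mset_mset)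

lemma distinct_insert_at: "distinct (insert_at i y xs) \<longleftrightarrow> y \<notin> set xs \<and> distinct xs"
  using mset_eq_imp_distinct_iff[of "insert_at i y xs" "y # xs"] by simp

lemma insert_at_inject:
  assumes "y \<notin> set xs" "y \<notin> set xs'" "i \<le> length xs" "i' \<le> length xs'"
    and "insert_at i y xs = insert_at i' y xs'"
  shows "xs = xs' \<and> i = i'"
proof -
  have "y \<notin> set (take i xs)" "y \<notin> set (take i' xs')" "y \<notin> set (drop i xs)" "y \<notin> set (drop i' xs')"
    using assms by (auto dest: in_set_takeD in_set_dropD)
  then have parts_eq: "take i xs = take i' xs'" "drop i xs = drop i' xs'"
    using assms(5) unfolding insert_at_def by (auto simp: append_Cons_eq_iff)
  then have "xs = xs'"
    by (metis append_take_drop_id)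
  moreover have "i = i'"
    using arg_cong[OF parts_eq(1), of length] assms(3,4) by simp
  ultimately show ?thesis by simp
qed

lemma bij_betw_insert_at_permutations_of_set:
  assumes "finite A" "y \<notin> A"
  shows "bij_betw (\<lambda>(xs, i). insert_at i y xs)
    (permutations_of_set A \<times> {..card A}) (permutations_of_set (insert y A))"
  unfolding bij_betw_def
proof (intro conjI)
  show "inj_on (\<lambda>(xs, i). insert_at i y xs) (permutations_of_set A \<times> {..card A})"
  proof (rule inj_onI, clarify)
    fix xs i xs' i'
    assume "xs \<in> permutations_of_set A" "xs' \<in> permutations_of_set A"
      and "i \<le> card A" "i' \<le> card A" and "insert_at i y xs = insert_at i' y xs'"
    then show "xs = xs' \<and> i = i'"
      using assms(2)
      by (intro insert_at_inject[of y])
        (auto simp: length_finite_permutations_of_set dest: permutations_of_setD)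
  qed
  show "(\<lambda>(xs, i). insert_at i y xs) ` (permutations_of_set A \<times> {..card A}) =
      permutations_of_set (insert y A)"
  proof (intro equalityI subsetI)
    fix ys assume ys: "ys \<in> permutations_of_set (insert y A)"
    then obtain us vs where ys_split: "ys = us @ y # vs"
      by (metis insertI1 permutations_of_setD(1) split_list)
    have "us @ vs \<in> permutations_of_set A"
      using ys assms(2) unfolding ys_split permutations_of_set_def by auto
    moreover from this have "length us \<le> card A"
      by (metis length_finite_permutations_of_set le_add1 length_append)
    moreover have "ys = insert_at (length us) y (us @ vs)"
      by (simp add: ys_split insert_at_def)
    ultimately show "ys \<in> (\<lambda>(xs, i). insert_at i y xs) ` (permutations_of_set A \<times> {..card A})"
      by (intro image_eqI[where x = "(us @ vs, length us)"]) auto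
  qed (use assms(2) in \<open>auto simp: permutations_of_set_def distinct_insert_at\<close>)
qed

lemma sum_permutations_of_set_insert:
  assumes "finite A" "y \<notin> A"
  shows "sum f (permutations_of_set (insert y A)) =
    (\<Sum>xs\<in>permutations_of_set A. \<Sum>i\<le>card A. f (insert_at i y xs))"
  using sum.reindex_bij_betw[OF bij_betw_insert_at_permutations_of_set[OF assms], of f]
  by (simp add: sum.cartesian_product split_def)

subsection \<open>Descents and ascents into a set\<close>

definition adjacent_indices :: "('a \<Rightarrow> 'a \<Rightarrow> bool) \<Rightarrow> 'a list \<Rightarrow> nat set" where
  "adjacent_indices R xs = {i. Suc i < length xs \<and> R (xs ! i) (xs ! Suc i)}"

lemma adjacent_indices_Nil [simp]: "adjacent_indices R [] = {}"
  and adjacent_indices_singleton [simp]: "adjacent_indices R [x] = {}"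
  by (simp_all add: adjacent_indices_def)

lemma adjacent_indices_subset: "adjacent_indices R xs \<subseteq> {..<length xs}"
  by (auto simp: adjacent_indices_def)

lemma finite_adjacent_indices [simp]: "finite (adjacent_indices R xs)"
  using adjacent_indices_subset finite_lessThan by (rule finite_subset)

lemma zero_in_adjacent_indices_Cons_Cons [simp]:
  "0 \<in> adjacent_indices R (x # y # xs) \<longleftrightarrow> R x y"
  by (simp add: adjacent_indices_def)

lemma Suc_in_adjacent_indices_Cons [simp]:
  "Suc i \<in> adjacent_indices R (x # xs) \<longleftrightarrow> i \<in> adjacent_indices R xs"
  by (simp add: adjacent_indices_def)

lemma card_adjacent_indices_Cons_Cons [simp]:
  "card (adjacent_indices R (x # y # xs)) = of_bool (R x y) + card (adjacent_indices R (y # xs))"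
proof -
  have "adjacent_indices R (x # y # xs) =
      (if R x y then {0} else {}) \<union> Suc ` adjacent_indices R (y # xs)" (is "?L = ?R")
  proof (rule set_eqI)
    show "i \<in> ?L \<longleftrightarrow> i \<in> ?R" for i by (cases i) auto
  qed
  then show ?thesis
    by (auto simp: card_insert_if card_image)
qed

definition descents_into :: "'a :: linorder set \<Rightarrow> 'a list \<Rightarrow> nat set" where
  "descents_into X = adjacent_indices (\<lambda>x y. x > y \<and> y \<in> X)"

definition ascents_into :: "'a :: linorder set \<Rightarrow> 'a list \<Rightarrow> nat set" where
  "ascents_into X = adjacent_indices (\<lambda>x y. x < y \<and> y \<in> X)"

lemma card_descents_into_plus_ascents_into:
  assumes "distinct \<sigma>" "\<sigma> \<noteq> []"
  shows "of_bool (hd \<sigma> \<in> X) + card (descents_into X \<sigma>) + card (ascents_into X \<sigma>) =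
    card (set \<sigma> \<inter> X)"
  using assms
proof (induction \<sigma> rule: induct_list012)
  case (3 x y zs)
  have "of_bool (y \<in> X) + card (descents_into X (y # zs)) + card (ascents_into X (y # zs)) =
      card (set (y # zs) \<inter> X)"
    using "3.IH"(2) "3.prems" by simp
  moreover have "card (set (x # y # zs) \<inter> X) = of_bool (x \<in> X) + card (set (y # zs) \<inter> X)"
    using "3.prems" by (simp add: Int_insert_left)
  moreover have "x < y \<or> y < x"
    using "3.prems" by auto
  ultimately show ?case
    by (auto simp: descents_into_def ascents_into_def)
qed (simp_all add: descents_into_def ascents_into_def)

lemma card_descents_into_Cons_upper_bound:
  assumes "\<sigma> \<noteq> []" "\<And>x. x \<in> set \<sigma> \<Longrightarrow> x < M"
  shows "card (descents_into X (M # \<sigma>)) = card (descents_into X \<sigma>) + of_bool (hd \<sigma> \<in> X)"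
  using assms by (cases \<sigma>) (simp_all add: descents_into_def)

lemma card_descents_into_insert_at_Suc:
  assumes "i < length \<sigma>" "distinct \<sigma>" "\<And>x. x \<in> set \<sigma> \<Longrightarrow> x < M"
  shows "card (descents_into X (insert_at (Suc i) M \<sigma>)) =
    card (descents_into X \<sigma>) + of_bool (i \<in> ascents_into X \<sigma>)"
  using assms
proof (induction \<sigma> arbitrary: i rule: induct_list012)
  case 1
  then show ?case by simp
next
  case (2 x)
  then show ?case by (simp add: descents_into_def ascents_into_def less_imp_not_less)
next
  case (3 x y zs)
  show ?case
  proof (cases i)
    case 0
    have "x < M" "y < M" "x \<noteq> y"
      using "3.prems" by auto
    with 0 show ?thesis
      by (auto simp: descents_into_def ascents_into_def)
  next
    case (Suc j)
    have "card (descents_into X (insert_at (Suc j) M (y # zs))) =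
        card (descents_into X (y # zs)) + of_bool (j \<in> ascents_into X (y # zs))"
      using "3.prems" Suc by (intro "3.IH"(2)) auto
    then show ?thesis
      by (simp add: Suc descents_into_def ascents_into_def)
  qed
qed

subsection \<open>The insertion recurrence\<close>

text \<open>The integer index spares the recurrence a special case at \<open>k = 0\<close>.\<close>

definition descent_class :: "'a :: linorder set \<Rightarrow> bool \<Rightarrow> int \<Rightarrow> 'a list set" where
  "descent_class X b k = {\<sigma>. int (card (descents_into X \<sigma>)) = k \<and> (hd \<sigma> \<in> X) = b}"

lemma Cons_upper_bound_in_descent_class:
  assumes "\<sigma> \<noteq> []" "\<And>x. x \<in> set \<sigma> \<Longrightarrow> x < M"
  shows "M # \<sigma> \<in> descent_class X b k \<longleftrightarrow>
    (M \<in> X) = b \<and> (\<sigma> \<in> descent_class X False k \<or> \<sigma> \<in> descent_class X True (k - 1))"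
  using card_descents_into_Cons_upper_bound[OF assms, of X] by (auto simp: descent_class_def)

lemma insert_at_Suc_in_descent_class:
  assumes "i < length \<sigma>" "distinct \<sigma>" "\<And>x. x \<in> set \<sigma> \<Longrightarrow> x < M"
  shows "insert_at (Suc i) M \<sigma> \<in> descent_class X b k \<longleftrightarrow>
    (if i \<in> ascents_into X \<sigma> then \<sigma> \<in> descent_class X b (k - 1) else \<sigma> \<in> descent_class X b k)"
proof -
  have "hd (insert_at (Suc i) M \<sigma>) = hd \<sigma>"
    using assms(1) by (cases \<sigma>) auto
  then show ?thesis
    using card_descents_into_insert_at_Suc[OF assms, of X] by (auto simp: descent_class_def)
qed

lemma count_later_insertion_slots_descent_class:
  assumes \<sigma>: "\<sigma> \<in> permutations_of_set A" and "A \<noteq> {}" and upper: "\<And>x. x \<in> A \<Longrightarrow> x < M"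
  shows "(\<Sum>i<card A. of_bool (insert_at (Suc i) M \<sigma> \<in> descent_class X b k)) =
    (int (card (A - X)) + k + of_bool b) * of_bool (\<sigma> \<in> descent_class X b k)
    + (int (card (A \<inter> X)) - (k - 1) - of_bool b) * of_bool (\<sigma> \<in> descent_class X b (k - 1))"
proof -
  let ?asc = "ascents_into X \<sigma>"
  have set_\<sigma>: "set \<sigma> = A" and distinct_\<sigma>: "distinct \<sigma>" and "\<sigma> \<noteq> []"
    using \<sigma> \<open>A \<noteq> {}\<close> by (auto dest: permutations_of_setD)
  then have length_\<sigma>: "length \<sigma> = card A"
    using distinct_card by force
  have asc_subset: "?asc \<subseteq> {..<card A}"
    unfolding ascents_into_def length_\<sigma>[symmetric] by (rule adjacent_indices_subset)
  have card_A: "card A = card (A - X) + card (A \<inter> X)"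
    using set_\<sigma> by (auto simp: card_Diff_subset_Int card_mono)
  have card_asc: "int (card ?asc) = int (card (A \<inter> X)) - l - of_bool c"
    if "\<sigma> \<in> descent_class X c l" for c l
    using that card_descents_into_plus_ascents_into[OF distinct_\<sigma> \<open>\<sigma> \<noteq> []\<close>, of X] set_\<sigma>
    by (auto simp: descent_class_def)
  have "(\<Sum>i<card A. of_bool (insert_at (Suc i) M \<sigma> \<in> descent_class X b k)) =
      (\<Sum>i<card A. if i \<in> ?asc then of_bool (\<sigma> \<in> descent_class X b (k - 1))
        else (of_bool (\<sigma> \<in> descent_class X b k) :: int))"
    using insert_at_Suc_in_descent_class[OF _ distinct_\<sigma> upper[folded set_\<sigma>], of _ X b k]
    by (intro sum.cong) (auto simp: length_\<sigma>)
  also have "\<dots> = int (card ?asc) * of_bool (\<sigma> \<in> descent_class X b (k - 1))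
      + int (card ({..<card A} - ?asc)) * of_bool (\<sigma> \<in> descent_class X b k)"
    using asc_subset by (simp add: sum.If_cases Int_absorb1 flip: Diff_eq)
  also have "int (card ({..<card A} - ?asc)) = int (card A) - int (card ?asc)"
    using asc_subset card_mono[OF _ asc_subset] by (simp add: card_Diff_subset finite_subset)
  finally show ?thesis
    using card_asc[of b k] card_asc[of b "k - 1"] by (auto simp: card_A)
qed

lemma count_insertion_slots_descent_class:
  assumes \<sigma>: "\<sigma> \<in> permutations_of_set A" and "A \<noteq> {}" and upper: "\<And>x. x \<in> A \<Longrightarrow> x < M"
  shows "(\<Sum>i\<le>card A. of_bool (insert_at i M \<sigma> \<in> descent_class X b k)) =
    of_bool ((M \<in> X) = b) *
      (of_bool (\<sigma> \<in> descent_class X False k) + of_bool (\<sigma> \<in> descent_class X True (k - 1)))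
    + (int (card (A - X)) + k + of_bool b) * of_bool (\<sigma> \<in> descent_class X b k)
    + (int (card (A \<inter> X)) - (k - 1) - of_bool b) * of_bool (\<sigma> \<in> descent_class X b (k - 1))"
proof -
  have "set \<sigma> = A" "\<sigma> \<noteq> []"
    using \<sigma> \<open>A \<noteq> {}\<close> by (auto dest: permutations_of_setD)
  moreover have "\<not> (\<sigma> \<in> descent_class X False k \<and> \<sigma> \<in> descent_class X True (k - 1))"
    by (auto simp: descent_class_def)
  ultimately have "(of_bool (insert_at 0 M \<sigma> \<in> descent_class X b k) :: int) =
      of_bool ((M \<in> X) = b) *
        (of_bool (\<sigma> \<in> descent_class X False k) + of_bool (\<sigma> \<in> descent_class X True (k - 1)))"
    using upper by (auto simp: Cons_upper_bound_in_descent_class)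
  then show ?thesis
    using count_later_insertion_slots_descent_class[OF assms, of X b k]
    by (simp only: sum.atMost_shift add.assoc)
qed

definition num_perms :: "'a :: linorder set \<Rightarrow> 'a set \<Rightarrow> bool \<Rightarrow> int \<Rightarrow> nat" where
  "num_perms X A b k = card (permutations_of_set A \<inter> descent_class X b k)"

lemma num_perms_insert_upper_bound:
  assumes "finite A" "A \<noteq> {}" "\<And>x. x \<in> A \<Longrightarrow> x < M"
  shows "int (num_perms X (insert M A) b k) =
    of_bool ((M \<in> X) = b) * (int (num_perms X A False k) + int (num_perms X A True (k - 1)))
    + (int (card (A - X)) + k + of_bool b) * int (num_perms X A b k)
    + (int (card (A \<inter> X)) - (k - 1) - of_bool b) * int (num_perms X A b (k - 1))"
proof -
  have num_perms_sum: "int (num_perms X B c l) =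
      (\<Sum>\<sigma>\<in>permutations_of_set B. of_bool (\<sigma> \<in> descent_class X c l))" for B c l
    by (simp add: num_perms_def)
  have "M \<notin> A"
    using assms(3) by blast
  then have "int (num_perms X (insert M A) b k) = (\<Sum>\<sigma>\<in>permutations_of_set A.
      \<Sum>i\<le>card A. of_bool (insert_at i M \<sigma> \<in> descent_class X b k))"
    unfolding num_perms_sum by (intro sum_permutations_of_set_insert assms(1))
  then show ?thesis
    by (simp only: count_insertion_slots_descent_class[OF _ assms(2,3)] num_perms_sum sum.distrib
        flip: sum_distrib_left cong: sum.cong)
qed

subsection \<open>Solving the recurrence\<close>

definition int_binomial :: "nat \<Rightarrow> int \<Rightarrow> int" where
  "int_binomial n k = (if k < 0 then 0 else int (n choose nat k))"

lemma int_binomial_of_nat [simp]: "int_binomial n (int k) = int (n choose k)"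
  by (simp add: int_binomial_def)

lemma int_binomial_Suc: "int_binomial (Suc n) k = int_binomial n (k - 1) + int_binomial n k"
proof (cases "nat k")
  case (Suc l)
  then have "k = int (Suc l)" by simp
  then show ?thesis
    by (simp add: int_binomial_def nat_add_distrib)
qed (auto simp: int_binomial_def)

lemma Suc_times_binomial_Suc: "Suc k * (n choose Suc k) = (n - k) * (n choose k)"
  by (metis binomial_absorb_comp binomial_absorption)

lemma int_binomial_absorption: "k * int_binomial n k = (int n - k + 1) * int_binomial n (k - 1)"
proof (cases "nat k")
  case (Suc l)
  then have k: "k = int (Suc l)" by simp
  have "int (Suc l * (n choose Suc l)) = int ((n - l) * (n choose l))"
    by (simp only: Suc_times_binomial_Suc)
  then have "int (Suc l) * int (n choose Suc l) = (int n - int l) * int (n choose l)"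
    by (cases "l \<le> n") (simp_all only: of_nat_mult of_nat_diff, simp add: binomial_eq_0)
  then show ?thesis
    unfolding k by (simp add: int_binomial_def nat_add_distrib)
qed (auto simp: int_binomial_def)

text \<open>Here \<open>p + 1\<close> letters lie outside \<open>X\<close> and \<open>q\<close> letters lie in \<open>X\<close>.\<close>

definition binomial_count :: "nat \<Rightarrow> nat \<Rightarrow> bool \<Rightarrow> int \<Rightarrow> int" where
  "binomial_count p q b k =
    fact (Suc p) * fact q * int_binomial p k * int_binomial q (k + of_bool b)"

lemma binomial_count_Suc_right:
  "binomial_count n (Suc n) b k =
    of_bool b * (binomial_count n n False k + binomial_count n n True (k - 1))
    + (int (Suc n) + k + of_bool b) * binomial_count n n b k
    + (int n - (k - 1) - of_bool b) * binomial_count n n b (k - 1)"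
  using int_binomial_absorption[of k n] int_binomial_absorption[of "k + 1" n]
    int_binomial_Suc[of n k] int_binomial_Suc[of n "k + 1"]
  by (cases b; simp add: binomial_count_def; algebra)

lemma binomial_count_Suc_left:
  "binomial_count (Suc n) (Suc n) b k =
    of_bool (\<not> b) *
      (binomial_count n (Suc n) False k + binomial_count n (Suc n) True (k - 1))
    + (int (Suc n) + k + of_bool b) * binomial_count n (Suc n) b k
    + (int (Suc n) - (k - 1) - of_bool b) * binomial_count n (Suc n) b (k - 1)"
  using int_binomial_absorption[of k n] int_binomial_absorption[of k "Suc n"]
    int_binomial_absorption[of "k + 1" "Suc n"]
    int_binomial_Suc[of n k]
  by (cases b; simp add: binomial_count_def; algebra)

lemma card_even_atLeastAtMost: "card ({1..m} \<inter> {x. even x}) = m div 2"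
proof (induction m)
  case 0
  then show ?case by simp
next
  case (Suc m)
  have "{1..Suc m} = insert (Suc m) {1..m}" by auto
  then show ?case
    using Suc by (simp add: Int_insert_left)
qed

lemma card_odd_atLeastAtMost: "card ({1..m} - {x. even x}) = Suc m div 2"
proof -
  have "card ({1..m} - {x. even x}) = m - m div 2"
    using card_Diff_subset_Int[of "{1..m}" "{x. even x}"] card_even_atLeastAtMost[of m] by simp
  then show ?thesis by presburger
qed

lemma num_perms_singleton: "num_perms X {x} b k = of_bool ((x \<in> X) = b \<and> k = 0)"
  by (auto simp: num_perms_def descent_class_def descents_into_def)

lemma num_perms_even_atLeastAtMost:
  "int (num_perms {x. even x} {1..Suc m} b k) = binomial_count (m div 2) (Suc m div 2) b k"
proof (induction m arbitrary: b k)
  case 0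
  show ?case
    by (cases b) (auto simp: num_perms_singleton binomial_count_def int_binomial_def binomial_eq_0)
next
  case (Suc m)
  let ?N = "binomial_count (m div 2) (Suc m div 2)"
  have "{1..Suc (Suc m)} = insert (Suc (Suc m)) {1..Suc m}"
    by auto
  then have recurrence: "int (num_perms {x. even x} {1..Suc (Suc m)} b k) =
      of_bool (even m = b) * (?N False k + ?N True (k - 1))
      + (int (Suc (Suc m) div 2) + k + of_bool b) * ?N b k
      + (int (Suc m div 2) - (k - 1) - of_bool b) * ?N b (k - 1)"
    using num_perms_insert_upper_bound[of "{1..Suc m}" "Suc (Suc m)" "{x. even x}" b k]
    by (simp only: Suc.IH card_even_atLeastAtMost card_odd_atLeastAtMost) simp
  show ?case
  proof (cases "even m")
    case True
    then obtain n where "m = 2 * n" ..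
    then show ?thesis
      using recurrence binomial_count_Suc_right[of n b k] by simp
  next
    case False
    then obtain n where "m = 2 * n + 1" ..
    then show ?thesis
      using recurrence binomial_count_Suc_left[of n b k] by simp
  qed
qed

lemma P_eq_num_perms:
  assumes "m \<ge> 1"
  shows "P 0 k m = num_perms {x. even x} {1..m} False (int k)"
    and "P 1 k m = num_perms {x. even x} {1..m} True (int k)"
proof -
  have "des_E \<sigma> = card (descents_into {x. even x} \<sigma>)" for \<sigma>
    by (simp add: des_E_def descents_into_def adjacent_indices_def)
  moreover have "hd \<sigma> = \<sigma> ! 0" if "\<sigma> \<in> permutations_of_set {1..m}" for \<sigma>
    using that assms by (intro hd_conv_nth) (auto dest: permutations_of_setD)
  ultimately show "P 0 k m = num_perms {x. even x} {1..m} False (int k)"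
    and "P 1 k m = num_perms {x. even x} {1..m} True (int k)"
    by (auto simp: P_def num_perms_def descent_class_def intro!: arg_cong[where f = card])
qed

lemma P_0_odd: "P 0 k (2 * n + 1) = (n + 1) * (n choose k)\<^sup>2 * (fact n)\<^sup>2"
proof -
  have "int (P 0 k (2 * n + 1)) = int ((n + 1) * (n choose k)\<^sup>2 * (fact n)\<^sup>2)"
    using num_perms_even_atLeastAtMost[of "2 * n" False "int k"]
    by (simp add: P_eq_num_perms binomial_count_def power2_eq_square algebra_simps)
  then show ?thesis
    by (simp only: of_nat_eq_iff)
qed

lemma P_1_odd: "P 1 k (2 * n + 1) = (n + 1) * (n choose k) * (n choose Suc k) * (fact n)\<^sup>2"
proof -
  have "int_binomial n (int k + 1) = int (n choose Suc k)"
    using int_binomial_of_nat[of n "Suc k"] by (simp add: add.commute)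
  then have "int (P 1 k (2 * n + 1)) = int ((n + 1) * (n choose k) * (n choose Suc k) * (fact n)\<^sup>2)"
    using num_perms_even_atLeastAtMost[of "2 * n" True "int k"] P_eq_num_perms(2)[of "2 * n + 1" k]
    by (simp add: binomial_count_def power2_eq_square algebra_simps)
  then show ?thesis
    by (simp only: of_nat_eq_iff)
qed

theorem theorem4p7:
  fixes n k :: nat
  assumes "n \<ge> 1" and "k \<le> n"
  shows "P 0 k (2 * n + 1) = (k + 1) * (n choose k) * ((n + 1) choose (k + 1)) * (fact n)\<^sup>2
    \<and> (k + 1) * (n choose k) * ((n + 1) choose (k + 1)) * (fact n)\<^sup>2
        = (n + 1) * (n choose k)\<^sup>2 * (fact n :: nat)\<^sup>2
    \<and> real (P 1 k (2 * n + 1))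
        = (real n + 1) * (real n - real k) / (real k + 1) * (real (n choose k))\<^sup>2 * (fact n)\<^sup>2"
proof -
  have "(k + 1) * ((n + 1) choose (k + 1)) = (n + 1) * (n choose k)"
    using Suc_times_binomial[of k n] by (simp del: binomial_Suc_Suc)
  then have product_forms_agree: "(k + 1) * (n choose k) * ((n + 1) choose (k + 1)) * (fact n)\<^sup>2
      = (n + 1) * (n choose k)\<^sup>2 * (fact n :: nat)\<^sup>2"
    by algebra
  have "real (Suc k * (n choose Suc k)) = real ((n - k) * (n choose k))"
    by (simp only: Suc_times_binomial_Suc)
  then have "real (n choose Suc k) = (real n - real k) / (real k + 1) * real (n choose k)"
    using assms(2) by (simp add: field_simps)
  moreover have "real (P 1 k (2 * n + 1)) =
      real (n + 1) * real (n choose k) * real (n choose Suc k) * (fact n)\<^sup>2"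
    by (simp only: P_1_odd of_nat_mult of_nat_power of_nat_fact)
  ultimately have "real (P 1 k (2 * n + 1))
      = (real n + 1) * (real n - real k) / (real k + 1) * (real (n choose k))\<^sup>2 * (fact n)\<^sup>2"
    by (simp add: power2_eq_square add.commute)
  then show ?thesis
    using P_0_odd[of k n] product_forms_agree by simp
qed

end
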